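(* Let $G$ be a finite group, let $H$ be a subgroup of $G$, and let $p$ be a prime. Then the restriction map $$\mathbb{Z}[\mathrm{IBr}(G)] \rightarrow \mathbb{Z}[\mathrm{IBr}(H)]$$ is injective if and only if every $p$-regular element of $G$ lies in some $G$-conjugate of $H$.
   Context: Fix a prime $p$ and a maximal ideal $M$ of the ring $\mathbf{R}$ of algebraic integers in $\mathbb{C}$ with $p \in M$; Brauer characters of all finite groups are computed with respect to this ideal. That is, $F = \mathbf{R}/M$ is an algebraically closed field of characteristic $p$, and the quotient map $\mathbf{R} \to F$ restricts to an isomorphism from the group of complex roots of unity of order prime to $p$ onto $F^\times$. An element of a finite group is $p$-regular if its order is not divisible by $p$. For a finite group $G$ and a finite-dimensional $F$-representation $\mathcal{X}$ of $G$, the Brauer character afforded by $\mathcal{X}$ is the complex-valued function on the set of $p$-regular elements of $G$ sending $g$ to the sum of the unique lifts, to complex roots of unity of order prime to $p$, of the eigenvalues of $\mathcal{X}(g)$ (counted with multiplicity). $\mathrm{IBr}(G)$ denotes the set of Brauer characters afforded by the irreducible $F$-representations of $G$. $\mathbb{Z}[\mathrm{IBr}(G)]$ denotes the ring of generalized Brauer characters of $G$, i.e. the set of $\mathbb{Z}$-linear combinations of elements of $\mathrm{IBr}(G)$, viewed as functions on the $p$-regular elements of $G$; it is a free abelian group with basis $\mathrm{IBr}(G)$. For a subgroup $H \le G$, the restriction map sends a generalized Brauer character of $G$ to its restriction to the $p$-regular elements of $H$, which is a generalized Brauer character of $H$. *)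

theory Defs
  imports
    "HOL-Algebra.QuotRing"
    "HOL-Algebra.Multiplicative_Group"
    "Jordan_Normal_Form.Char_Poly"
    "Jordan_Normal_Form.VS_Connect"
begin

definition alg_int_ring :: "complex ring" where
  "alg_int_ring = class_ring\<lparr>carrier := {z. algebraic_int z}\<rparr>"

text \<open>The field \<open>F = R/M\<close> is represented by a field type \<open>'f\<close> together with a ring
  isomorphism \<open>\<iota>\<close> from \<open>alg_int_ring Quot M\<close> onto it, so that the matrix library applies.
  The quotient map \<open>R \<rightarrow> F\<close> is then the following function; it is only meaningful on
  algebraic integers.\<close>

definition residue_map :: "complex set \<Rightarrow> (complex set \<Rightarrow> 'f) \<Rightarrow> complex \<Rightarrow> 'f::field" where
  "residue_map M \<iota> z = \<iota> (M +>\<^bsub>alg_int_ring\<^esub> z)"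

definition p_regular :: "nat \<Rightarrow> ('g, 'b) monoid_scheme \<Rightarrow> 'g set" where
  "p_regular p G = {g \<in> carrier G. \<not> p dvd group.ord G g}"

text \<open>Degree \<open>n\<close> representations are homomorphisms \<open>G \<rightarrow> GL\<^sub>n(F)\<close>; the group
  \<open>GL\<^sub>n(F)\<close> is the unit group of the matrix ring.\<close>

definition representation ::
  "('g, 'b) monoid_scheme \<Rightarrow> nat \<Rightarrow> ('g \<Rightarrow> 'f::field mat) \<Rightarrow> bool" where
  "representation G n X \<longleftrightarrow> X \<in> hom G (units_of (ring_mat TYPE('f) n ()))"

definition irreducible_representation ::
  "('g, 'b) monoid_scheme \<Rightarrow> nat \<Rightarrow> ('g \<Rightarrow> 'f::field mat) \<Rightarrow> bool" where
  "irreducible_representation G n X \<longleftrightarrow>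
     representation G n X \<and> n > 0 \<and>
     (\<forall>W. VectorSpace.subspace class_ring W (module_vec TYPE('f) n) \<and>
          (\<forall>g\<in>carrier G. \<forall>w\<in>W. X g *\<^sub>v w \<in> W) \<longrightarrow>
          W = {0\<^sub>v n} \<or> W = carrier_vec n)"

text \<open>A complex number is a root of unity of order prime to \<open>p\<close> iff some positive power
  of it with exponent prime to \<open>p\<close> is 1. The parameter \<open>r\<close> below is the quotient map
  \<open>R \<rightarrow> F\<close>.\<close>

definition p'_root_of_unity :: "nat \<Rightarrow> complex \<Rightarrow> bool" where
  "p'_root_of_unity p z \<longleftrightarrow> (\<exists>m>0. coprime m p \<and> z ^ m = 1)"

definition brauer_lift :: "nat \<Rightarrow> (complex \<Rightarrow> 'f) \<Rightarrow> 'f::field \<Rightarrow> complex" where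
  "brauer_lift p r a = (THE z. p'_root_of_unity p z \<and> r z = a)"

text \<open>Functions on the \<open>p\<close>-regular elements are encoded as extensional functions, i.e. they
  take the value \<open>undefined\<close> elsewhere.\<close>

definition brauer_character ::
  "nat \<Rightarrow> (complex \<Rightarrow> 'f) \<Rightarrow> ('g, 'b) monoid_scheme \<Rightarrow> ('g \<Rightarrow> 'f::field mat) \<Rightarrow> 'g \<Rightarrow> complex" where
  "brauer_character p r G X =
     (\<lambda>g\<in>p_regular p G. \<Sum>a\<in>#proots (char_poly (X g)). brauer_lift p r a)"

definition IBr ::
  "nat \<Rightarrow> (complex \<Rightarrow> 'f::field) \<Rightarrow> ('g, 'b) monoid_scheme \<Rightarrow> ('g \<Rightarrow> complex) set" where
  "IBr p r G = {brauer_character p r G X |X n. irreducible_representation G n X}"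

text \<open>Linear combinations are taken over finite subsets, so that the definition does not
  presuppose finiteness of \<open>IBr\<close>.\<close>

definition generalized_brauer_characters ::
  "nat \<Rightarrow> (complex \<Rightarrow> 'f::field) \<Rightarrow> ('g, 'b) monoid_scheme \<Rightarrow> ('g \<Rightarrow> complex) set" where
  "generalized_brauer_characters p r G =
     {(\<lambda>g\<in>p_regular p G. \<Sum>\<phi>\<in>S. of_int (c \<phi>) * \<phi> g) |S (c :: ('g \<Rightarrow> complex) \<Rightarrow> int).
        finite S \<and> S \<subseteq> IBr p r G}"

definition brauer_restriction ::
  "nat \<Rightarrow> ('g, 'b) monoid_scheme \<Rightarrow> 'g set \<Rightarrow> ('g \<Rightarrow> complex) \<Rightarrow> 'g \<Rightarrow> complex" where
  "brauer_restriction p G H \<phi> = restrict \<phi> (p_regular p (G\<lparr>carrier := H\<rparr>))"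

end

theory Submission
  imports Defs "Jordan_Normal_Form.Schur_Decomposition"
begin

text \<open>
  Brauer characters are class functions, so a generalized Brauer character is determined by its
  values on \<open>H\<close> as soon as every \<open>p\<close>-regular element is conjugate into \<open>H\<close>.

  Conversely, let the \<open>p\<close>-regular element \<open>x\<close> not be conjugate into \<open>H\<close>, let \<open>n = |G : H|\<close> and let
  \<open>u g\<close> be the number of fixed points of \<open>g\<close> on \<open>G/H\<close>. Then \<open>u x = 0\<close>, whereas \<open>1 \<le> u h \<le> n\<close> for
  \<open>h \<in> H\<close>, so \<open>f = (1 - u) (2 - u) \<cdots> (n - u)\<close> vanishes on \<open>H\<close> and \<open>f x = n! \<noteq> 0\<close>. Since \<open>u ^ k\<close> is
  the permutation character of \<open>G\<close> on \<open>(G/H) ^ k\<close>, the function \<open>f\<close> is a \<open>\<int>\<close>-combination of permutation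
  characters. These are generalized Brauer characters: the Brauer character of any representation is
  the sum of those of its composition factors, and the eigenvalues over \<open>F\<close> of a permutation matrix
  are the residues of its complex eigenvalues, whose sum is the trace.
\<close>

section \<open>The residue map on algebraic integers\<close>

locale residue_setting =
  fixes p :: nat and M :: "complex set" and \<iota> :: "complex set \<Rightarrow> 'f::field"
  assumes prime_p: "Factorial_Ring.prime p"
    and maximal_M: "maximalideal M alg_int_ring"
    and p_in_M: "of_nat p \<in> M"
    and iso: "\<iota> \<in> ring_iso (alg_int_ring Quot M) (class_ring :: 'f ring)"
begin

abbreviation r :: "complex \<Rightarrow> 'f" where "r \<equiv> residue_map M \<iota>"

sublocale ideal M "alg_int_ring"
  using maximal_M by (rule maximalideal.axioms)

text \<open>The closure properties of algebraic integers come for free, since \<^prop>\<open>maximalideal M alg_int_ring\<close>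
  includes that \<^term>\<open>alg_int_ring\<close> is a ring.\<close>

lemma alg_int_add: "algebraic_int (x + y)" if "algebraic_int x" "algebraic_int y" for x y :: complex
  using a_closed[of x y] that by (simp add: alg_int_ring_def)

lemma alg_int_mult: "algebraic_int (x * y)" if "algebraic_int x" "algebraic_int y" for x y :: complex
  using m_closed[of x y] that by (simp add: alg_int_ring_def)

lemma alg_int_diff: "algebraic_int (x - y)" if "algebraic_int x" "algebraic_int y" for x y :: complex
  using alg_int_add[of x "- y"] that by auto

text \<open>The residue map is the projection onto the cosets of \<open>M\<close> followed by
  \<open>\<iota>\<close>. Its arithmetic is available only on algebraic integers, hence the
  integrality conditions carried along below.\<close>

lemma residue_map_hom: "r \<in> Ring.ring_hom alg_int_ring (class_ring :: 'f ring)"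
proof -
  have "\<iota> \<circ> (+>\<^bsub>alg_int_ring\<^esub>) M \<in> Ring.ring_hom alg_int_ring (class_ring :: 'f ring)"
    using rcos_ring_hom iso by (intro Ring.ring_hom_trans[of _ _ "alg_int_ring Quot M"]) (auto simp: ring_iso_def)
  moreover have "\<iota> \<circ> (+>\<^bsub>alg_int_ring\<^esub>) M = r"
    by (auto simp: residue_map_def)
  ultimately show ?thesis by simp
qed

lemma residue_map_add: "r (x + y) = r x + r y" if "algebraic_int x" "algebraic_int y"
  using ring_hom_add[OF residue_map_hom, of x y] that by (simp add: alg_int_ring_def)

lemma residue_map_mult: "r (x * y) = r x * r y" if "algebraic_int x" "algebraic_int y"
  using ring_hom_mult[OF residue_map_hom, of x y] that by (simp add: alg_int_ring_def)

lemma residue_map_1: "r 1 = 1"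
  using ring_hom_one[OF residue_map_hom] by (simp add: alg_int_ring_def)

lemma residue_map_0: "r 0 = 0"
proof -
  have "r 0 + r 0 = r 0 + 0"
    using residue_map_add[of 0 0] by simp
  then show ?thesis by (rule add_left_imp_eq)
qed

lemma residue_map_diff: "r (x - y) = r x - r y" if "algebraic_int x" "algebraic_int y"
  using residue_map_add[of "x - y" y] that alg_int_diff[of x y] by (simp add: algebra_simps)

lemma residue_map_of_nat: "r (of_nat n) = of_nat n"
  by (induction n) (auto simp: residue_map_0 residue_map_1 residue_map_add)

lemma residue_map_of_int: "r (of_int k) = of_int k"
  by (cases k rule: int_diff_cases) (simp add: residue_map_diff residue_map_of_nat)

lemma alg_int_power: "algebraic_int (x ^ n)" if "algebraic_int x" for x :: complex
  by (induction n) (auto intro: alg_int_mult that)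

lemma residue_map_power: "r (x ^ n) = r x ^ n" if "algebraic_int x"
  by (induction n) (auto simp: residue_map_1 residue_map_mult that alg_int_power)

lemma alg_int_sum: "algebraic_int (sum f A)" if "\<And>i. i \<in> A \<Longrightarrow> algebraic_int (f i)" for f :: "'i \<Rightarrow> complex"
  using that by (induction A rule: infinite_finite_induct) (auto intro: alg_int_add)

lemma residue_map_sum: "r (sum f A) = (\<Sum>i\<in>A. r (f i))" if "\<And>i. i \<in> A \<Longrightarrow> algebraic_int (f i)"
  using that by (induction A rule: infinite_finite_induct)
    (auto simp: residue_map_0 residue_map_add alg_int_sum)

lemma of_nat_p_eq_0: "(of_nat p :: 'f) = 0"
proof -
  have "M +>\<^bsub>alg_int_ring\<^esub> of_nat p = M +>\<^bsub>alg_int_ring\<^esub> 0"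
    using a_rcos_const[OF p_in_M] a_rcos_const[OF additive_subgroup.zero_closed[OF additive_subgroup_axioms]] by (simp add: alg_int_ring_def)
  then have "r (of_nat p) = r 0"
    by (simp add: residue_map_def)
  then show ?thesis
    by (simp add: residue_map_of_nat residue_map_0)
qed

text \<open>A Bezout relation \<open>m * u + p * v = 1\<close> would reduce to \<open>0 = 1\<close>
  in the residue field, where \<open>p\<close> is already zero.\<close>

lemma of_nat_coprime_neq_0: "(of_nat m :: 'f) \<noteq> 0" if "coprime m p"
proof
  assume m0: "(of_nat m :: 'f) = 0"
  have "coprime (int m) (int p)"
    using that by simp
  then obtain u v where "int m * u + int p * v = 1"
    using coprime_iff_gcd_eq_1 bezout_int[of "int m" "int p"] by (metis mult.commute)
  then have "(of_int (int m * u + int p * v) :: 'f) = 1"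
    by simp
  then show False
    using m0 of_nat_p_eq_0 by simp
qed

lemma algebraic_int_root_of_unity: "algebraic_int z" if "z ^ m = 1" "m > 0" for z :: complex
  by (rule algebraic_int_root[of 1 "Polynomial.monom 1 m"])
    (use that in \<open>auto simp: poly_monom degree_monom_eq\<close>)

lemma residue_map_eq_1_imp: "u = 1" if "u ^ m = 1" "m > 0" "coprime m p" "r u = 1"
proof (rule ccontr)
  assume "u \<noteq> 1"
  \<comment> \<open>The vanishing geometric sum of \<open>u\<close> would reduce to \<open>m = 0\<close> in \<open>F\<close>.\<close>
  then have "(\<Sum>i<m. u ^ i) = 0"
    using that(1) by (simp add: sum_gp_strict)
  then have "r (\<Sum>i<m. u ^ i) = 0"
    by (simp add: residue_map_0)
  moreover have "r (\<Sum>i<m. u ^ i) = of_nat m"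
    using algebraic_int_root_of_unity[OF that(1,2)] that(4)
    by (simp add: residue_map_sum residue_map_power alg_int_power)
  ultimately show False
    using of_nat_coprime_neq_0[OF that(3)] by simp
qed

text \<open>This is injectivity of the residue map on roots of unity of order prime to
  \<open>p\<close>: the quotient of two lifts of the same element is such a root of unity with
  residue 1, hence equal to 1.\<close>

lemma brauer_lift_residue_map: "brauer_lift p r (r z) = z" if z: "p'_root_of_unity p z"
  unfolding brauer_lift_def
proof (rule the_equality)
  fix w assume w: "p'_root_of_unity p w \<and> r w = r z"
  obtain m where m: "m > 0" "coprime m p" "z ^ m = 1"
    using z by (auto simp: p'_root_of_unity_def)
  obtain k where k: "k > 0" "coprime k p" "w ^ k = 1"
    using w by (auto simp: p'_root_of_unity_def)
  have N: "m * k > 0" "coprime (m * k) p" "z ^ (m * k) = 1" "w ^ (m * k) = 1"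
    using m k power_mult[of z m k] power_mult[of w k m] by (simp_all add: mult.commute[of k m])
  \<comment> \<open>The power of \<open>z\<close> is its inverse, so \<open>?u\<close> is
    \<open>w / z\<close>, written as a product of algebraic integers to let
    \<open>residue_map_mult\<close> apply.\<close>
  let ?u = "w * z ^ (m * k - 1)"
  have u: "z * z ^ (m * k - 1) = 1"
    using N(1,3) by (metis power_minus_mult mult.commute)
  have ai: "algebraic_int w" "algebraic_int z"
    using algebraic_int_root_of_unity m k by auto
  have "?u ^ (m * k) = 1"
    using N by (simp only: power_mult_distrib power_commuting_commutes mult_1
        power_one flip: power_mult mult.commute[of "m * k" "m * k - 1"] power_mult[of z "m * k" "m * k - 1"])
      (simp add: power_mult)
  moreover have "r ?u = r (z * z ^ (m * k - 1))"
    using w ai by (simp add: residue_map_mult alg_int_power)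
  ultimately have "?u = 1"
    using residue_map_eq_1_imp[OF _ N(1,2), of ?u] u by (simp add: residue_map_1)
  with u show "w = z"
    by (metis mult.commute mult.left_commute mult.right_neutral)
qed (use z in auto)

text \<open>Since \<open>r\<close> is multiplicative only on algebraic integers, general facts on
  \<open>map_poly\<close> along ring homomorphisms do not apply. The induction therefore carries
  integrality of the coefficients together with the factorization.\<close>

lemma map_poly_residue_linear_factors:
  assumes "\<And>a. a \<in> set as \<Longrightarrow> algebraic_int a"
  shows "algebraic_int (coeff (\<Prod>a\<leftarrow>as. [:- a, 1:]) i)"
    and "map_poly r (\<Prod>a\<leftarrow>as. [:- a, 1:]) = (\<Prod>a\<leftarrow>as. [:- r a, 1:])"
proof -
  have "(\<forall>i. algebraic_int (coeff (\<Prod>a\<leftarrow>as. [:- a, 1:]) i)) \<and>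
        map_poly r (\<Prod>a\<leftarrow>as. [:- a, 1:]) = (\<Prod>a\<leftarrow>as. [:- r a, 1:])"
    using assms
  proof (induction as)
    case Nil
    then show ?case by (auto simp: residue_map_1)
  next
    case (Cons b as)
    let ?q = "\<Prod>a\<leftarrow>as. [:- a, 1:]"
    have IH: "algebraic_int (coeff ?q i)" "map_poly r ?q = (\<Prod>a\<leftarrow>as. [:- r a, 1:])" for i
      using Cons by auto
    have b: "algebraic_int b" using Cons by simp
    \<comment> \<open>Multiplying by a linear factor is a shift minus a scalar multiple, so only
      differences and products of algebraic integers have to be reduced.\<close>
    have c: "coeff ([:- b, 1:] * ?q) i = coeff (pCons 0 ?q) i - b * coeff ?q i" for i
      by simp
    have c0: "algebraic_int (coeff (pCons 0 ?q) i)" for i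
      using IH(1) by (cases i) auto
    have "map_poly r ([:- b, 1:] * ?q) = [:- r b, 1:] * map_poly r ?q"
    proof (rule poly_eqI)
      fix i
      have "coeff (map_poly r ([:- b, 1:] * ?q)) i = r (coeff (pCons 0 ?q) i) - r b * r (coeff ?q i)"
        unfolding coeff_map_poly[where f = r, OF residue_map_0] c
        using IH b c0 by (simp add: residue_map_diff residue_map_mult alg_int_mult)
      also have "\<dots> = coeff ([:- r b, 1:] * map_poly r ?q) i"
        by (cases i) (auto simp: coeff_map_poly residue_map_0)
      finally show "coeff (map_poly r ([:- b, 1:] * ?q)) i = coeff ([:- r b, 1:] * map_poly r ?q) i" .
    qed
    moreover have "algebraic_int (coeff ([:- b, 1:] * ?q) i)" for i
      unfolding c using IH b c0 by (intro alg_int_diff alg_int_mult)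
    ultimately show ?case using IH by auto
  qed
  then show "algebraic_int (coeff (\<Prod>a\<leftarrow>as. [:- a, 1:]) i)"
    and "map_poly r (\<Prod>a\<leftarrow>as. [:- a, 1:]) = (\<Prod>a\<leftarrow>as. [:- r a, 1:])" by auto
qed

end

section \<open>Eigenvalues of integer matrices of finite order\<close>

lemma trace_mult_commute:
  fixes A B :: "'a::comm_semiring_1 mat"
  assumes "A \<in> carrier_mat n m" "B \<in> carrier_mat m n"
  shows "(\<Sum>i<n. (A * B) $$ (i, i)) = (\<Sum>i<m. (B * A) $$ (i, i))"
proof -
  have "(\<Sum>i<n. (A * B) $$ (i, i)) = (\<Sum>i<n. \<Sum>j<m. A $$ (i, j) * B $$ (j, i))"
    using assms by (intro sum.cong) (auto simp: scalar_prod_def lessThan_atLeast0)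
  also have "\<dots> = (\<Sum>j<m. \<Sum>i<n. B $$ (j, i) * A $$ (i, j))"
    by (subst sum.swap) (simp add: mult.commute)
  also have "\<dots> = (\<Sum>i<m. (B * A) $$ (i, i))"
    using assms by (intro sum.cong) (auto simp: scalar_prod_def lessThan_atLeast0)
  finally show ?thesis .
qed

text \<open>Schur decomposition writes \<open>A = P * B * Q\<close> with the eigenvalues on the
  diagonal of \<open>B\<close>; moving \<open>P * B\<close> past \<open>Q\<close> under the trace
  leaves the trace of \<open>B\<close>.\<close>

lemma trace_eq_sum_eigenvalues:
  fixes A :: "complex mat"
  assumes A: "A \<in> carrier_mat n n" and cp: "char_poly A = (\<Prod>a\<leftarrow>as. [:- a, 1:])"
  shows "(\<Sum>i<n. A $$ (i, i)) = sum_list as"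
proof -
  obtain B P Q where BPQ: "schur_decomposition A as = (B, P, Q)"
    by (cases "schur_decomposition A as") auto
  from schur_decomposition[OF A cp BPQ]
  have wit: "similar_mat_wit A B P Q" and diag: "diag_mat B = as" by auto
  from similar_mat_witD2[OF A wit]
  have BPQ: "B \<in> carrier_mat n n" "P \<in> carrier_mat n n" "Q \<in> carrier_mat n n"
    and inv: "Q * P = 1\<^sub>m n" and eq: "A = P * B * Q" by auto
  have "(\<Sum>i<n. A $$ (i, i)) = (\<Sum>i<n. (Q * (P * B)) $$ (i, i))"
    unfolding eq using BPQ by (intro trace_mult_commute) auto
  also have "Q * (P * B) = B"
    using BPQ inv by (simp flip: assoc_mult_mat[of Q n n P n B n])
  also have "(\<Sum>i<n. B $$ (i, i)) = sum_list as"
    using BPQ by (simp add: diag[symmetric] diag_mat_def interv_sum_list_conv_sum_set_nat lessThan_atLeast0)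
  finally show ?thesis .
qed

text \<open>For an eigenvector \<open>v\<close>, the identity \<open>A ^ m = 1\<close> gives
  \<open>a ^ m * v = v\<close>, to be compared at a nonzero coordinate.\<close>

lemma root_char_poly_of_finite_order:
  fixes A :: "'a::field mat"
  assumes A: "A \<in> carrier_mat n n" and pow: "A ^\<^sub>m m = 1\<^sub>m n" and root: "poly (char_poly A) a = 0"
  shows "a ^ m = 1"
proof -
  obtain v where v: "eigenvector A v a"
    using root eigenvalue_root_char_poly[OF A] by (auto simp: eigenvalue_def)
  then have vc: "v \<in> carrier_vec n" "v \<noteq> 0\<^sub>v n"
    using A by (auto simp: eigenvector_def)
  have "a ^ m \<cdot>\<^sub>v v = v"
    using eigenvector_pow[OF A v, of m] pow vc by simp
  moreover obtain i where i: "i < n" "v $ i \<noteq> 0"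
    using vc by (metis eq_vecI carrier_vecD index_zero_vec)
  ultimately have "a ^ m * v $ i = v $ i"
    using vc by (metis carrier_vecD index_smult_vec(1))
  with i show ?thesis by simp
qed

context residue_setting
begin

text \<open>The characteristic polynomials over \<complex> and over the residue field come from the
  same integer polynomial. Hence the eigenvalues over the field are residues of the complex ones;
  these are \<open>m\<close>-th roots of unity, so lifting recovers them and their sum is the
  trace.\<close>

lemma brauer_sum_integer_matrix:
  fixes A :: "int mat"
  assumes A: "A \<in> carrier_mat n n" and pow: "A ^\<^sub>m m = 1\<^sub>m n" and m: "m > 0" "coprime m p"
  shows "(\<Sum>a\<in>#proots (char_poly (map_mat of_int A :: 'f mat)). brauer_lift p r a) = of_int (\<Sum>i<n. A $$ (i, i))"
proof -
  let ?C = "map_mat of_int A :: complex mat"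
  have C: "?C \<in> carrier_mat n n" using A by simp
  obtain as where as: "char_poly ?C = (\<Prod>a\<leftarrow>as. [:- a, 1:])"
    using char_poly_factorized[OF C] by auto
  have Cpow: "?C ^\<^sub>m m = 1\<^sub>m n"
    unfolding of_int_hom.mat_hom_pow[OF A, symmetric] pow by (rule of_int_hom.mat_hom_one)
  have rt: "a ^ m = 1" if "a \<in> set as" for a
    using that by (intro root_char_poly_of_finite_order[OF C Cpow]) (simp add: as poly_prod_list_zero_iff)
  then have ai: "algebraic_int a" if "a \<in> set as" for a
    using that algebraic_int_root_of_unity m by blast
  have "char_poly (map_mat of_int A :: 'f mat) = map_poly of_int (char_poly A)"
    by (rule of_int_hom.char_poly_hom[OF A])
  \<comment> \<open>The residue map sends each integer to its image in the field, so the integer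
    coefficients may be read in \<complex> first.\<close>
  also have "\<dots> = map_poly r (map_poly of_int (char_poly A))"
    by (intro poly_eqI) (simp add: coeff_map_poly residue_map_0 residue_map_of_int)
  also have "map_poly of_int (char_poly A) = char_poly ?C"
    by (rule of_int_hom.char_poly_hom[OF A, symmetric])
  also have "map_poly r (char_poly ?C) = (\<Prod>a\<leftarrow>as. [:- r a, 1:])"
    unfolding as by (rule map_poly_residue_linear_factors) (rule ai)
  finally have cp: "char_poly (map_mat of_int A :: 'f mat) = (\<Prod>a\<leftarrow>map r as. [:- a, 1:])"
    by (simp add: o_def)
  have proots_linear: "proots (\<Prod>a\<leftarrow>bs. [:- a, 1:]) = mset bs" for bs :: "'f list"
  proof (induction bs)
    case (Cons b bs)
    have "(\<Prod>a\<leftarrow>bs. [:- a, 1:]) \<noteq> 0"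
      by auto
    then show ?case
      using Cons proots_mult[of "[:- b, 1:]" "\<Prod>a\<leftarrow>bs. [:- a, 1:]"]
      by (simp del: mult_pCons_left)
  qed simp
  have "(\<Sum>a\<in>#proots (char_poly (map_mat of_int A :: 'f mat)). brauer_lift p r a) =
      (\<Sum>a\<leftarrow>as. brauer_lift p r (r a))"
    unfolding cp proots_linear by (simp add: multiset.map_comp o_def sum_mset_sum_list flip: mset_map)
  also have "\<dots> = sum_list (map id as)"
    using rt m by (intro arg_cong[of _ _ sum_list] map_cong refl)
      (auto intro!: brauer_lift_residue_map exI[of _ m] simp: p'_root_of_unity_def)
  also have "\<dots> = (\<Sum>i<n. ?C $$ (i, i))"
    using trace_eq_sum_eigenvalues[OF C as] by simp
  also have "\<dots> = of_int (\<Sum>i<n. A $$ (i, i))"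
    using A by simp
  finally show ?thesis .
qed

end

section \<open>Composition factors\<close>

text \<open>Membership in the unit group is automatic: \<open>X (inv g)\<close> is a two-sided
  inverse of \<open>X g\<close>.\<close>

lemma representationI:
  fixes X :: "'g \<Rightarrow> 'f::field mat"
  assumes "group G" and carr: "\<And>g. g \<in> carrier G \<Longrightarrow> X g \<in> carrier_mat n n"
    and one: "X \<one>\<^bsub>G\<^esub> = 1\<^sub>m n"
    and mult: "\<And>g h. g \<in> carrier G \<Longrightarrow> h \<in> carrier G \<Longrightarrow> X (g \<otimes>\<^bsub>G\<^esub> h) = X g * X h"
  shows "representation G n X"
proof -
  interpret group G by fact
  have "X g \<in> Units (ring_mat TYPE('f) n ())" if g: "g \<in> carrier G" for g
  proof -
    have "X (inv\<^bsub>G\<^esub> g) * X g = 1\<^sub>m n" "X g * X (inv\<^bsub>G\<^esub> g) = 1\<^sub>m n"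
      using g one by (simp_all flip: mult)
    then show ?thesis
      using g carr[of g] carr[of "inv\<^bsub>G\<^esub> g"] by (auto simp: Units_def ring_mat_simps)
  qed
  then show ?thesis
    using mult by (auto simp: representation_def hom_def units_of_def ring_mat_simps)
qed

lemma representationD:
  fixes X :: "'g \<Rightarrow> 'f::field mat"
  assumes "group G" "representation G n X"
  shows "g \<in> carrier G \<Longrightarrow> X g \<in> carrier_mat n n"
    and "X \<one>\<^bsub>G\<^esub> = 1\<^sub>m n"
    and "g \<in> carrier G \<Longrightarrow> h \<in> carrier G \<Longrightarrow> X (g \<otimes>\<^bsub>G\<^esub> h) = X g * X h"
proof -
  let ?R = "ring_mat TYPE('f) n ()"
  interpret R: ring ?R by (rule ring_mat)
  have hom: "X \<in> hom G (units_of ?R)"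
    using assms(2) by (simp add: representation_def)
  interpret group_hom G "units_of ?R" X
    using assms(1) R.units_group hom by (intro group_hom.intro group_hom_axioms.intro)
  show "g \<in> carrier G \<Longrightarrow> X g \<in> carrier_mat n n"
    using hom_closed[of g] by (auto simp: units_of_def Units_def ring_mat_simps)
  show "X \<one>\<^bsub>G\<^esub> = 1\<^sub>m n"
    using hom_one by (simp add: units_of_def ring_mat_simps)
  show "g \<in> carrier G \<Longrightarrow> h \<in> carrier G \<Longrightarrow> X (g \<otimes>\<^bsub>G\<^esub> h) = X g * X h"
    using hom_mult[of g h] by (simp add: units_of_def ring_mat_simps)
qed

lemma mult_mat_unit_vec:
  fixes A :: "'a::semiring_1 mat"
  assumes "A \<in> carrier_mat m n" "j < n"
  shows "A *\<^sub>v unit_vec n j = col A j"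
  using assms by (intro eq_vecI) auto

lemma exists_adapted_basis:
  fixes W :: "'a::field vec set"
  assumes W: "W \<subseteq> carrier_vec n"
  obtains P Q k where "P \<in> carrier_mat n n" "Q \<in> carrier_mat n n" "P * Q = 1\<^sub>m n" "Q * P = 1\<^sub>m n"
    "k \<le> n" "\<And>j. j < k \<Longrightarrow> col P j \<in> W"
    "\<And>w i. w \<in> W \<Longrightarrow> k \<le> i \<Longrightarrow> i < n \<Longrightarrow> (Q *\<^sub>v w) $ i = 0"
proof -
  \<comment> \<open>Take the invertible \<open>P\<close> with as many leading columns in \<open>W\<close> as possible; a \<open>w \<in> W\<close> with a
    nonzero coordinate \<open>i \<ge> k\<close> could be exchanged for column \<open>i\<close>.\<close>
  define good where "good k \<longleftrightarrow> k \<le> n \<and>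
    (\<exists>P\<in>carrier_mat n n. det P \<noteq> 0 \<and> (\<forall>j<k. col P j \<in> W))" for k
  have "good 0"
    by (auto simp: good_def intro!: bexI[of _ "1\<^sub>m n"])
  then obtain k where k: "good k" and max: "\<And>l. good l \<Longrightarrow> l \<le> k"
    using Nat.ex_has_greatest_nat[of good 0 n] by (auto simp: good_def)
  obtain P where kn: "k \<le> n" and P: "P \<in> carrier_mat n n" "det P \<noteq> 0" and PW: "\<And>j. j < k \<Longrightarrow> col P j \<in> W"
    using k by (auto simp: good_def)
  obtain Q where Q: "Q \<in> carrier_mat n n" "P * Q = 1\<^sub>m n" "Q * P = 1\<^sub>m n"
    using det_non_zero_imp_unit[OF P, of "()"] by (auto simp: Units_def ring_mat_simps)
  have zero: "(Q *\<^sub>v w) $ i = 0" if w: "w \<in> W" and i: "k \<le> i" "i < n" for w i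
  proof (rule ccontr)
    define c where "c = Q *\<^sub>v w"
    assume "(Q *\<^sub>v w) $ i \<noteq> 0"
    then have ci: "c $ i \<noteq> 0" by (simp add: c_def)
    have c: "c \<in> carrier_vec n" and wn: "w \<in> carrier_vec n"
      using Q w W by (auto simp: c_def)
    \<comment> \<open>Column \<open>k\<close> of \<open>P * E\<close> is
      \<open>P *\<^sub>v c = w\<close>, and if \<open>i \<noteq> k\<close>, the old column
      \<open>k\<close> of \<open>P\<close> moves to position \<open>i\<close>. All other columns
      stay.\<close>
    define E where "E = mat n n (\<lambda>(a, b). if b = k then c $ a
      else if b = i then (if a = k then 1 else 0) else if a = b then 1 else 0)"
    have E: "E \<in> carrier_mat n n" by (simp add: E_def)
    have "v = 0\<^sub>v n" if v: "v \<in> carrier_vec n" "E *\<^sub>v v = 0\<^sub>v n" for v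
    proof -
      \<comment> \<open>This is row \<open>a\<close> of \<open>E *\<^sub>v v = 0\<close>. Row
        \<open>i\<close> reads \<open>c $ i * v $ k = 0\<close>, which forces
        \<open>v $ k = 0\<close>; then row \<open>k\<close> gives \<open>v $ i = 0\<close>, and each
        other row gives its own coordinate.\<close>
      have row: "c $ a * v $ k + (if a = k then (if i = k then 0 else v $ i)
          else if a = i then 0 else v $ a) = 0" if a: "a < n" for a
      proof -
        have "0 = (E *\<^sub>v v) $ a" using v a by simp
        also have "\<dots> = (\<Sum>b<n. E $$ (a, b) * v $ b)"
          using a v(1) E by (simp add: scalar_prod_def lessThan_atLeast0)
        also have "\<dots> = (\<Sum>b<n. (if b = k then c $ a * v $ k else 0)
          + (if b = (if a = k then i else a) then (if a = k then (if i = k then 0 else v $ i)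
          else if a = i then 0 else v $ a) else 0))"
          using a i by (intro sum.cong) (auto simp: E_def)
        also have "\<dots> = c $ a * v $ k + (if a = k then (if i = k then 0 else v $ i)
          else if a = i then 0 else v $ a)"
          using a i by (auto simp: sum.distrib)
        finally show ?thesis by simp
      qed
      have vk: "v $ k = 0"
        using row[of i] i ci by (auto split: if_splits)
      have vi: "v $ i = 0"
        using row[of k] i vk by (auto split: if_splits)
      have "v $ a = 0" if "a < n" for a
        using row[OF that] vk vi by (auto split: if_splits)
      with v show ?thesis by (intro eq_vecI) auto
    qed
    then have "det E \<noteq> 0"
      using det_0_iff_vec_prod_zero_field[OF E] by blast
    then have det: "det (P * E) \<noteq> 0"
      using P E by (simp add: det_mult)
    have "col (P * E) j \<in> W" if j: "j < Suc k" for j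
    proof (cases "j = k")
      case True
      have "col E k = c"
        using c i kn by (intro eq_vecI) (auto simp: E_def)
      then have "col (P * E) j = P *\<^sub>v (Q *\<^sub>v w)"
        using True col_mult2[OF P(1) E, of k] i by (simp add: c_def)
      also have "\<dots> = w"
        using P Q wn by (simp flip: assoc_mult_mat_vec)
      finally show ?thesis using w by simp
    next
      case False
      then have "col E j = unit_vec n j"
        using j i by (intro eq_vecI) (auto simp: E_def unit_vec_def)
      then have "col (P * E) j = col P j"
        using col_mult2[OF P(1) E, of j] mult_mat_unit_vec[OF P(1), of j] i j by simp
      then show ?thesis using PW False j by simp
    qed
    then have "good (Suc k)"
      using P E det i by (auto simp: good_def intro!: bexI[of _ "P * E"])
    then show False using max[of "Suc k"] by simp
  qed
  show thesis
    by (rule that[OF P(1) Q kn PW zero])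
qed

text \<open>The characteristic matrix is again block upper triangular, so its determinant is the
  product over the diagonal blocks.\<close>

lemma char_poly_four_block_lower_left_zero:
  fixes A :: "'a::field mat"
  assumes A: "A \<in> carrier_mat k k" and B: "B \<in> carrier_mat k l" and D: "D \<in> carrier_mat l l"
  shows "char_poly (four_block_mat A B (0\<^sub>m l k) D) = char_poly A * char_poly D"
proof -
  let ?neg = "map_mat (\<lambda>a. [:- a:])"
  have "char_poly_matrix (four_block_mat A B (0\<^sub>m l k) D) =
      four_block_mat (char_poly_matrix A) (?neg B) (0\<^sub>m l k) (char_poly_matrix D)"
    using A B D by (intro eq_matI) (auto simp: char_poly_matrix_def one_poly_def)
  then show ?thesis
    unfolding char_poly_def using A B D
    by (simp add: det_four_block_mat_lower_left_zero[of _ k _ l])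
qed

text \<open>In a basis adapted to a proper nonzero invariant subspace \<open>W\<close> all matrices
  become block upper triangular. The diagonal blocks are the representations on \<open>W\<close> and
  on the quotient by \<open>W\<close>. Only characteristic polynomials are recorded, as Brauer
  characters depend on nothing else.\<close>

lemma reducible_representation_blocks:
  fixes X :: "'g \<Rightarrow> 'f::field mat"
  assumes G: "group G" and rep: "representation G n X" and n: "n > 0"
    and red: "\<not> irreducible_representation G n X"
  obtains k l Y Z where "k < n" "l < n" "representation G k Y" "representation G l Z"
    "\<And>g. g \<in> carrier G \<Longrightarrow> char_poly (X g) = char_poly (Y g) * char_poly (Z g)"
proof -
  note X = representationD[OF G rep]
  obtain W where sub: "VectorSpace.subspace class_ring W (module_vec TYPE('f) n)"
    and inv: "\<And>g w. g \<in> carrier G \<Longrightarrow> w \<in> W \<Longrightarrow> X g *\<^sub>v w \<in> W"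
    and W0: "W \<noteq> {0\<^sub>v n}" and Wn: "W \<noteq> carrier_vec n"
    using red rep n by (auto simp: irreducible_representation_def)
  have sm: "submodule class_ring W (module_vec TYPE('f) n)"
    using sub by (rule VectorSpace.subspace.submod)
  have W: "W \<subseteq> carrier_vec n" and zero: "0\<^sub>v n \<in> W"
    and add: "\<And>v w. v \<in> W \<Longrightarrow> w \<in> W \<Longrightarrow> v + w \<in> W"
    and smult: "\<And>c w. w \<in> W \<Longrightarrow> c \<cdot>\<^sub>v w \<in> W"
    using submodule.subset[OF sm] submodule.zero_closed[OF sm] submodule.m_closed[OF sm]
      submodule.smult_closed[OF sm] by (auto simp: module_vec_simps)
  obtain P Q k where P: "P \<in> carrier_mat n n" and Q: "Q \<in> carrier_mat n n"
    and PQ: "P * Q = 1\<^sub>m n" "Q * P = 1\<^sub>m n" and k: "k \<le> n"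
    and PW: "\<And>j. j < k \<Longrightarrow> col P j \<in> W"
    and QW: "\<And>w i. w \<in> W \<Longrightarrow> k \<le> i \<Longrightarrow> i < n \<Longrightarrow> (Q *\<^sub>v w) $ i = 0"
    using exists_adapted_basis[OF W] by blast
  have PQv: "P *\<^sub>v (Q *\<^sub>v w) = w" if "w \<in> carrier_vec n" for w
    using that P Q PQ by (simp flip: assoc_mult_mat_vec)
  have P0: "P *\<^sub>v 0\<^sub>v n = 0\<^sub>v n"
    using P by (intro eq_vecI) auto
  \<comment> \<open>For \<open>k = 0\<close> all coordinates of every element of \<open>W\<close>
    vanish, so \<open>W\<close> would be zero.\<close>
  have "k > 0"
  proof (rule ccontr)
    assume "\<not> k > 0"
    then have "w = 0\<^sub>v n" if "w \<in> W" for w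
    proof -
      have "Q *\<^sub>v w = 0\<^sub>v n"
        using \<open>\<not> k > 0\<close> QW[OF that] Q by (intro eq_vecI) auto
      then show ?thesis
        using PQv[of w] P0 that W by auto
    qed
    with W0 zero show False by blast
  qed
  \<comment> \<open>For \<open>k = n\<close> all columns of the invertible \<open>P\<close> lie in
    \<open>W\<close>, so \<open>W\<close> would be the whole space.\<close>
  have "k < n"
  proof (rule ccontr)
    assume "\<not> k < n"
    then have kn: "k = n" using k by simp
    have "w \<in> W" if w: "w \<in> carrier_vec n" for w
    proof -
      define c where "c = Q *\<^sub>v w"
      \<comment> \<open>The combination \<open>P *\<^sub>v c\<close> is built up one column at a
        time, each partial sum staying in \<open>W\<close>.\<close>
      have "P *\<^sub>v vec n (\<lambda>i. if i < l then c $ i else 0) \<in> W" if "l \<le> n" for l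
        using that
      proof (induction l)
        case 0
        have "vec n (\<lambda>i. if i < 0 then c $ i else 0) = 0\<^sub>v n"
          by (intro eq_vecI) auto
        then show ?case using zero P0 by simp
      next
        case (Suc l)
        let ?v = "\<lambda>l. vec n (\<lambda>i. if i < l then c $ i else 0)"
        have "?v (Suc l) = ?v l + c $ l \<cdot>\<^sub>v unit_vec n l"
          using Suc.prems by (intro eq_vecI) (auto simp: unit_vec_def less_Suc_eq)
        then have "P *\<^sub>v ?v (Suc l) = P *\<^sub>v ?v l + c $ l \<cdot>\<^sub>v col P l"
          using P Suc.prems by (simp add: mult_add_distrib_mat_vec[of P n n] mult_mat_vec[of P n n]
              mult_mat_unit_vec[of P n n])
        then show ?case
          using Suc PW[of l] kn by (auto intro: add smult)
      qed
      from this[of n] have "P *\<^sub>v vec n (\<lambda>i. if i < n then c $ i else 0) \<in> W"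
        by simp
      moreover have "vec n (\<lambda>i. if i < n then c $ i else 0) = Q *\<^sub>v w"
        using Q by (intro eq_vecI) (auto simp: c_def)
      ultimately show ?thesis using PQv[OF w] by simp
    qed
    with W Wn show False by blast
  qed
  define l where "l = n - k"
  have n_eq: "n = k + l" and l: "l < n"
    using \<open>k < n\<close> \<open>k > 0\<close> by (auto simp: l_def)
  have closed: "A * B \<in> carrier_mat n n"
    if "A \<in> carrier_mat n n" "B \<in> carrier_mat n n" for A B :: "'f mat"
    using that by simp
  have assoc: "A * B * C = A * (B * C)"
    if "A \<in> carrier_mat n n" "B \<in> carrier_mat n n" "C \<in> carrier_mat n n" for A B C :: "'f mat"
    using that by (rule assoc_mult_mat)
  have cancel: "P * (Q * A) = A" if "A \<in> carrier_mat n n" for A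
    using that assoc[OF P Q that] PQ by simp
  define T where "T g = Q * X g * P" for g
  have T: "T g \<in> carrier_mat n n" if "g \<in> carrier G" for g
    using X(1)[OF that] P Q by (simp add: T_def)
  have T1: "T \<one>\<^bsub>G\<^esub> = 1\<^sub>m n"
    using X(2) P Q PQ by (simp add: T_def)
  have Tm: "T (g \<otimes>\<^bsub>G\<^esub> h) = T g * T h" if "g \<in> carrier G" "h \<in> carrier G" for g h
  proof -
    have c: "X g \<in> carrier_mat n n" "X h \<in> carrier_mat n n" using X(1) that by auto
    have "T g * T h = Q * (X g * (P * (Q * (X h * P))))"
      using c P Q by (simp add: T_def assoc closed)
    also have "P * (Q * (X h * P)) = X h * P"
      using c P by (simp add: cancel closed)
    finally show ?thesis
      using c P Q that by (simp add: T_def X(3) assoc closed)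
  qed
  \<comment> \<open>\<open>X g\<close> maps column \<open>j\<close> of \<open>P\<close> into
    \<open>W\<close>, and elements of \<open>W\<close> have zero coordinates from \<open>k\<close>
    on.\<close>
  have T0: "T g $$ (i, j) = 0" if "g \<in> carrier G" "k \<le> i" "i < n" "j < k" for g i j
  proof -
    have c: "X g \<in> carrier_mat n n" using X(1) that by auto
    have "T g $$ (i, j) = col (T g) j $ i"
      using carrier_matD[OF T[OF that(1)]] that k by simp
    also have "col (T g) j = Q *\<^sub>v (X g *\<^sub>v col P j)"
      using that k by (simp only: T_def assoc[OF Q c P] col_mult2[OF Q closed[OF c P]] col_mult2[OF c P])
    also have "(Q *\<^sub>v (X g *\<^sub>v col P j)) $ i = 0"
      using QW[of "X g *\<^sub>v col P j" i] inv[of g "col P j"] PW[of j] that by simp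
    finally show ?thesis .
  qed
  have sum_split: "(\<Sum>a<i + j. f a) = (\<Sum>a<i. f a) + (\<Sum>a<j. f (i + a))" for f :: "nat \<Rightarrow> 'f" and i j
    by (induction j) (auto simp: add.assoc)
  \<comment> \<open>The sum is cut at \<open>k\<close> because \<open>T0\<close> kills one half in
    each diagonal block: the second for \<open>Y\<close>, the first for \<open>Z\<close>.\<close>
  have Tsum: "T (g \<otimes>\<^bsub>G\<^esub> h) $$ (i, j) =
      (\<Sum>a<k. T g $$ (i, a) * T h $$ (a, j)) + (\<Sum>a<l. T g $$ (i, k + a) * T h $$ (k + a, j))"
    if "g \<in> carrier G" "h \<in> carrier G" "i < n" "j < n" for g h i j
    unfolding Tm[OF that(1,2)] using carrier_matD[OF T[OF that(1)]] carrier_matD[OF T[OF that(2)]] that n_eq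
    by (simp add: scalar_prod_def sum_split flip: lessThan_atLeast0)
  define Y where "Y g = mat k k (\<lambda>(i, j). T g $$ (i, j))" for g
  define U where "U g = mat k l (\<lambda>(i, j). T g $$ (i, k + j))" for g
  define Z where "Z g = mat l l (\<lambda>(i, j). T g $$ (k + i, k + j))" for g
  have Y: "Y g \<in> carrier_mat k k" and U: "U g \<in> carrier_mat k l" and Z: "Z g \<in> carrier_mat l l" for g
    by (auto simp: Y_def U_def Z_def)
  have "representation G k Y"
  proof (rule representationI[OF G Y])
    show "Y \<one>\<^bsub>G\<^esub> = 1\<^sub>m k"
      using T1 n_eq by (intro eq_matI) (auto simp: Y_def)
    show "Y (g \<otimes>\<^bsub>G\<^esub> h) = Y g * Y h" if "g \<in> carrier G" "h \<in> carrier G" for g h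
      using that n_eq by (intro eq_matI)
        (auto simp: Y_def scalar_prod_def Tsum T0 simp flip: lessThan_atLeast0)
  qed
  moreover have "representation G l Z"
  proof (rule representationI[OF G Z])
    show "Z \<one>\<^bsub>G\<^esub> = 1\<^sub>m l"
      using T1 n_eq by (intro eq_matI) (auto simp: Z_def)
    show "Z (g \<otimes>\<^bsub>G\<^esub> h) = Z g * Z h" if "g \<in> carrier G" "h \<in> carrier G" for g h
      using that n_eq by (intro eq_matI)
        (auto simp: Z_def scalar_prod_def Tsum T0 simp flip: lessThan_atLeast0)
  qed
  moreover have "char_poly (X g) = char_poly (Y g) * char_poly (Z g)" if g: "g \<in> carrier G" for g
  proof -
    have c: "X g \<in> carrier_mat n n" using X(1) g .
    have "P * T g * Q = P * (Q * (X g * (P * Q)))"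
      using c P Q by (simp add: T_def assoc closed)
    also have "\<dots> = X g"
      using c PQ(1) by (simp add: cancel)
    finally have "similar_mat (X g) (T g)"
      using c P Q PQ T[OF g] by (intro similar_matI[of _ _ P Q n]) auto
    moreover have "T g = four_block_mat (Y g) (U g) (0\<^sub>m l k) (Z g)"
      using T[OF g] T0[OF g] n_eq by (intro eq_matI) (auto simp: Y_def U_def Z_def)
    ultimately show ?thesis
      using char_poly_four_block_lower_left_zero[OF Y U Z] by (simp add: char_poly_similar)
  qed
  ultimately show thesis
    using that[of k l Y Z] \<open>k < n\<close> l by blast
qed

section \<open>Generalized Brauer characters\<close>

lemma generalized_brauer_characters_0:
  "(\<lambda>x\<in>p_regular p G. 0) \<in> generalized_brauer_characters p r G"
  unfolding generalized_brauer_characters_def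
  by (rule CollectI, rule exI[of _ "{}"]) auto

lemma generalized_brauer_characters_lincomb:
  fixes a b :: int
  assumes "f \<in> generalized_brauer_characters p r G" "h \<in> generalized_brauer_characters p r G"
  shows "(\<lambda>x\<in>p_regular p G. of_int a * f x + of_int b * h x) \<in> generalized_brauer_characters p r G"
proof -
  obtain S c where S: "finite S" "S \<subseteq> IBr p r G"
    and f: "f = (\<lambda>x\<in>p_regular p G. \<Sum>\<phi>\<in>S. of_int (c \<phi> :: int) * \<phi> x)"
    using assms(1) by (auto simp: generalized_brauer_characters_def)
  obtain T d where T: "finite T" "T \<subseteq> IBr p r G"
    and h: "h = (\<lambda>x\<in>p_regular p G. \<Sum>\<phi>\<in>T. of_int (d \<phi> :: int) * \<phi> x)"
    using assms(2) by (auto simp: generalized_brauer_characters_def)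
  \<comment> \<open>\<open>S\<close> and \<open>T\<close> may overlap, so both coefficient functions
    are extended by zero and added.\<close>
  define e where "e \<phi> = (if \<phi> \<in> S then a * c \<phi> else 0) + (if \<phi> \<in> T then b * d \<phi> else 0)" for \<phi>
  have "(\<Sum>\<phi>\<in>S \<union> T. of_int (e \<phi>) * \<phi> x) =
      of_int a * (\<Sum>\<phi>\<in>S. of_int (c \<phi>) * \<phi> x) + of_int b * (\<Sum>\<phi>\<in>T. of_int (d \<phi>) * \<phi> x)" for x
  proof -
    have "(\<Sum>\<phi>\<in>S \<union> T. of_int (e \<phi>) * \<phi> x) =
        (\<Sum>\<phi>\<in>S \<union> T. if \<phi> \<in> S then of_int (a * c \<phi>) * \<phi> x else 0) +
        (\<Sum>\<phi>\<in>S \<union> T. if \<phi> \<in> T then of_int (b * d \<phi>) * \<phi> x else 0)"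
      unfolding sum.distrib[symmetric] by (intro sum.cong) (auto simp: e_def algebra_simps)
    also have "(\<Sum>\<phi>\<in>S \<union> T. if \<phi> \<in> S then of_int (a * c \<phi>) * \<phi> x else 0) =
        (\<Sum>\<phi>\<in>S. of_int (a * c \<phi>) * \<phi> x)"
      using S T by (intro sum.mono_neutral_cong_right) auto
    also have "(\<Sum>\<phi>\<in>S \<union> T. if \<phi> \<in> T then of_int (b * d \<phi>) * \<phi> x else 0) =
        (\<Sum>\<phi>\<in>T. of_int (b * d \<phi>) * \<phi> x)"
      using S T by (intro sum.mono_neutral_cong_right) auto
    finally show ?thesis
      by (simp add: sum_distrib_left mult.assoc)
  qed
  then have "(\<lambda>x\<in>p_regular p G. of_int a * f x + of_int b * h x) =
      (\<lambda>x\<in>p_regular p G. \<Sum>\<phi>\<in>S \<union> T. of_int (e \<phi>) * \<phi> x)"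
    by (auto simp: f h)
  then show ?thesis
    unfolding generalized_brauer_characters_def using S T
    by (intro CollectI exI[of _ "S \<union> T"] exI[of _ e]) auto
qed

lemma generalized_brauer_characters_sum:
  fixes c :: "'i \<Rightarrow> int"
  assumes "finite I" "\<And>i. i \<in> I \<Longrightarrow> f i \<in> generalized_brauer_characters p r G"
  shows "(\<lambda>x\<in>p_regular p G. \<Sum>i\<in>I. of_int (c i) * f i x) \<in> generalized_brauer_characters p r G"
  using assms
proof (induction I)
  case empty
  show ?case by (simp only: sum.empty generalized_brauer_characters_0)
next
  case (insert i I)
  then have "(\<lambda>x\<in>p_regular p G. of_int (c i) * f i x +
      of_int 1 * (\<lambda>x\<in>p_regular p G. \<Sum>i\<in>I. of_int (c i) * f i x) x) \<in> generalized_brauer_characters p r G"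
    by (intro generalized_brauer_characters_lincomb) auto
  also have "(\<lambda>x\<in>p_regular p G. of_int (c i) * f i x +
      of_int 1 * (\<lambda>x\<in>p_regular p G. \<Sum>i\<in>I. of_int (c i) * f i x) x) =
      (\<lambda>x\<in>p_regular p G. \<Sum>i\<in>insert i I. of_int (c i) * f i x)"
    using insert by (auto simp: restrict_def)
  finally show ?case .
qed

lemma IBr_subset_generalized_brauer_characters:
  "IBr p r G \<subseteq> generalized_brauer_characters p r G"
proof
  fix \<phi> assume \<phi>: "\<phi> \<in> IBr p r G"
  then have "\<phi> = (\<lambda>x\<in>p_regular p G. \<Sum>\<psi>\<in>{\<phi>}. of_int 1 * \<psi> x)"
    by (auto simp: IBr_def brauer_character_def restrict_def)
  with \<phi> show "\<phi> \<in> generalized_brauer_characters p r G"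
    unfolding generalized_brauer_characters_def
    by (intro CollectI exI[of _ "{\<phi>}"] exI[of _ "\<lambda>_. 1"]) auto
qed

text \<open>Strong induction on the degree: a reducible representation has the Brauer character of
  its two diagonal blocks together, because the roots of a product of polynomials are joined with
  multiplicity.\<close>

lemma brauer_character_in_generalized:
  fixes X :: "'g \<Rightarrow> 'f::field mat"
  assumes G: "group G" and rep: "representation G n X"
  shows "brauer_character p r G X \<in> generalized_brauer_characters p r G"
  using rep
proof (induction n arbitrary: X rule: less_induct)
  case (less n X)
  note X = representationD[OF G less.prems]
  consider "n = 0" | "irreducible_representation G n X" | "n > 0" "\<not> irreducible_representation G n X"
    by blast
  then show ?case
  proof cases
    case 1
    \<comment> \<open>Degree 0 is neither irreducible nor split further; the empty determinant is 1
      and has no roots, so the character is the empty sum.\<close>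
    have "proots (char_poly (X g)) = {#}" if "g \<in> carrier G" for g
      using X(1)[OF that] 1 by (simp add: char_poly_def det_def char_poly_matrix_def)
    then have "brauer_character p r G X = (\<lambda>x\<in>p_regular p G. 0)"
      by (auto simp: brauer_character_def p_regular_def)
    then show ?thesis
      by (simp only: generalized_brauer_characters_0)
  next
    case 2
    then have "brauer_character p r G X \<in> IBr p r G"
      by (auto simp: IBr_def)
    then show ?thesis
      using IBr_subset_generalized_brauer_characters by blast
  next
    case 3
    obtain k l Y Z where "k < n" "l < n" and Y: "representation G k Y" and Z: "representation G l Z"
      and cp: "\<And>g. g \<in> carrier G \<Longrightarrow> char_poly (X g) = char_poly (Y g) * char_poly (Z g)"
      using reducible_representation_blocks[OF G less.prems 3] by blast
    have "proots (char_poly (X g)) = proots (char_poly (Y g)) + proots (char_poly (Z g))"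
      if g: "g \<in> carrier G" for g
    proof -
      have "char_poly (X g) \<noteq> 0"
        using degree_monic_char_poly[OF X(1)[OF g]] by auto
      then show ?thesis
        unfolding cp[OF g] by (intro proots_mult) auto
    qed
    then have "brauer_character p r G X = (\<lambda>x\<in>p_regular p G.
        of_int 1 * brauer_character p r G Y x + of_int 1 * brauer_character p r G Z x)"
      by (auto simp: brauer_character_def p_regular_def)
    then show ?thesis
      using generalized_brauer_characters_lincomb[OF less.IH[OF \<open>k < n\<close> Y] less.IH[OF \<open>l < n\<close> Z], of 1 1]
      by (simp only:)
  qed
qed

section \<open>Permutation characters as generalized Brauer characters\<close>

lemma (in residue_setting) permutation_character_in_generalized:
  fixes G :: "('g, 'b) monoid_scheme"
  assumes G: "group G" and finG: "finite (carrier G)" and fin: "finite \<Omega>"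
    and act: "\<And>g x. g \<in> carrier G \<Longrightarrow> x \<in> \<Omega> \<Longrightarrow> act g x \<in> \<Omega>"
    and act_one: "\<And>x. x \<in> \<Omega> \<Longrightarrow> act \<one>\<^bsub>G\<^esub> x = x"
    and act_mult: "\<And>g h x. g \<in> carrier G \<Longrightarrow> h \<in> carrier G \<Longrightarrow> x \<in> \<Omega> \<Longrightarrow>
      act (g \<otimes>\<^bsub>G\<^esub> h) x = act g (act h x)"
  shows "(\<lambda>g\<in>p_regular p G. of_nat (card {x \<in> \<Omega>. act g x = x})) \<in> generalized_brauer_characters p r G"
proof -
  interpret G: group G by fact
  obtain xs where xs: "distinct xs" "set xs = \<Omega>"
    using finite_distinct_list[OF fin] by blast
  define n where "n = length xs"
  \<comment> \<open>The permutation matrices are taken over the integers, so that they can be read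
    both over \<complex> and over the residue field.\<close>
  define A where "A g = mat n n (\<lambda>(i, j). if xs ! i = act g (xs ! j) then 1 else 0 :: int)" for g
  have A: "A g \<in> carrier_mat n n" for g by (simp add: A_def)
  have mem: "xs ! i \<in> \<Omega>" if "i < n" for i
    using that xs by (auto simp: n_def)
  have A_one: "A \<one>\<^bsub>G\<^esub> = 1\<^sub>m n"
    using xs by (intro eq_matI) (auto simp: A_def act_one mem nth_eq_iff_index_eq n_def)
  have A_mult: "A (g \<otimes>\<^bsub>G\<^esub> h) = A g * A h" if g: "g \<in> carrier G" and h: "h \<in> carrier G" for g h
  proof (rule eq_matI)
    fix i j assume "i < dim_row (A g * A h)" "j < dim_col (A g * A h)"
    then have i: "i < n" and j: "j < n" by (auto simp: A_def)
    obtain k where k: "k < n" "xs ! k = act h (xs ! j)"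
      using act[OF h mem[OF j]] xs by (metis in_set_conv_nth n_def)
    have "(A g * A h) $$ (i, j) = (\<Sum>l<n. A g $$ (i, l) * A h $$ (l, j))"
      using i j carrier_matD[OF A] by (simp add: scalar_prod_def lessThan_atLeast0)
    \<comment> \<open>Column \<open>j\<close> of \<open>A h\<close> has its only nonzero entry at
      the position \<open>k\<close> of \<open>act h (xs ! j)\<close>.\<close>
    also have "\<dots> = (\<Sum>l<n. if l = k then A g $$ (i, k) else 0)"
      using i j k(1) xs(1) unfolding n_def
      by (intro sum.cong) (auto simp: A_def n_def nth_eq_iff_index_eq simp flip: k(2))
    also have "\<dots> = A (g \<otimes>\<^bsub>G\<^esub> h) $$ (i, j)"
      using i j k by (simp add: A_def act_mult[OF g h mem[OF j]])
    finally show "A (g \<otimes>\<^bsub>G\<^esub> h) $$ (i, j) = (A g * A h) $$ (i, j)" ..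
  qed (auto simp: A_def)
  have A_pow: "A (g [^]\<^bsub>G\<^esub> m) = A g ^\<^sub>m m" if "g \<in> carrier G" for g and m :: nat
    by (induction m) (use that A_one A_mult A[of g] in auto)
  define X :: "'g \<Rightarrow> 'f mat" where "X g = map_mat of_int (A g)" for g
  have "representation G n X"
  proof (rule representationI[OF G])
    show "X \<one>\<^bsub>G\<^esub> = 1\<^sub>m n"
      by (simp add: X_def A_one of_int_hom.mat_hom_one)
    show "X (g \<otimes>\<^bsub>G\<^esub> h) = X g * X h" if "g \<in> carrier G" "h \<in> carrier G" for g h
      using that by (simp add: X_def A_mult of_int_hom.mat_hom_mult[OF A A])
  qed (use A in \<open>auto simp: X_def\<close>)
  then have "brauer_character p r G X \<in> generalized_brauer_characters p r G"
    by (rule brauer_character_in_generalized[OF G])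
  also have "brauer_character p r G X = (\<lambda>g\<in>p_regular p G. of_nat (card {x \<in> \<Omega>. act g x = x}))"
    unfolding brauer_character_def
  proof (rule restrict_ext)
    fix g assume g: "g \<in> p_regular p G"
    then have gG: "g \<in> carrier G" by (simp add: p_regular_def)
    have m: "G.ord g > 0" "coprime (G.ord g) p"
      using g gG finG prime_p G.ord_ge_1[of g] by (auto simp: p_regular_def coprime_commute prime_imp_coprime)
    have "A g ^\<^sub>m G.ord g = 1\<^sub>m n"
      using A_pow[OF gG, of "G.ord g"] gG by (simp add: A_one)
    from brauer_sum_integer_matrix[OF A this m]
    have "(\<Sum>a\<in>#proots (char_poly (X g)). brauer_lift p r a) = of_int (\<Sum>i<n. A g $$ (i, i))"
      by (simp add: X_def)
    \<comment> \<open>A diagonal entry is 1 exactly at a fixed point, so the trace counts fixed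
      points.\<close>
    also have "(\<Sum>i<n. A g $$ (i, i)) = (\<Sum>i<n. if act g (xs ! i) = xs ! i then 1 else 0)"
      by (intro sum.cong) (auto simp: A_def)
    also have "\<dots> = (\<Sum>x\<in>\<Omega>. if act g x = x then 1 else 0)"
      using xs by (intro sum.reindex_bij_betw bij_betw_nth) (auto simp: n_def)
    also have "\<dots> = int (card {x \<in> \<Omega>. act g x = x})"
      using fin by (simp add: sum.If_cases Int_def)
    finally show "(\<Sum>a\<in>#proots (char_poly (X g)). brauer_lift p r a) =
      of_nat (card {x \<in> \<Omega>. act g x = x})" by simp
  qed
  finally show ?thesis .
qed

section \<open>Conjugation invariance and restriction to a subgroup\<close>

context
  fixes G (structure) assumes G: "group G"
begin

interpretation G: group G by (rule G)

text \<open>\<open>ord\<close> is defined through the exponents that give \<one>, so this yields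
  equal orders for conjugate elements.\<close>

lemma conj_pow_eq_one_iff:
  assumes "g \<in> carrier G" "h \<in> carrier G"
  shows "(g \<otimes> h \<otimes> inv g) [^] (n::nat) = \<one> \<longleftrightarrow> h [^] n = \<one>"
proof -
  have "(g \<otimes> h \<otimes> inv g) [^] n = g \<otimes> h [^] n \<otimes> inv g"
  proof (induction n)
    case (Suc n)
    have "inv g \<otimes> (g \<otimes> (h \<otimes> inv g)) = h \<otimes> inv g"
      using assms by (simp flip: G.m_assoc)
    then show ?case
      using assms Suc by (simp add: G.m_assoc)
  qed (use assms in simp)
  moreover have "g \<otimes> h [^] n \<otimes> inv g = \<one> \<longleftrightarrow> h [^] n = \<one>"
    using assms G.inv_solve_right[of \<one> "g \<otimes> h [^] n" g] by auto
  ultimately show ?thesis by simp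
qed

lemma conj_in_p_regular_iff:
  assumes "g \<in> carrier G" "h \<in> carrier G"
  shows "g \<otimes> h \<otimes> inv g \<in> p_regular p G \<longleftrightarrow> h \<in> p_regular p G"
  using assms by (simp add: p_regular_def G.ord_def conj_pow_eq_one_iff)

text \<open>Powers, and hence orders, agree in \<open>H\<close> and in \<open>G\<close>.\<close>

lemma p_regular_subgroup:
  assumes "subgroup H G"
  shows "p_regular p (G\<lparr>carrier := H\<rparr>) = p_regular p G \<inter> H"
proof -
  interpret H: group "G\<lparr>carrier := H\<rparr>"
    using assms G.subgroup_imp_group by blast
  show ?thesis
    using subgroup.subset[OF assms]
    by (auto simp: p_regular_def H.ord_def G.ord_def simp flip: G.nat_pow_consistent)
qed

text \<open>\<open>X g\<close> conjugates \<open>X h\<close> into the matrix of the conjugate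
  element, and similar matrices have the same characteristic polynomial.\<close>

lemma brauer_character_conj:
  fixes X :: "'a \<Rightarrow> 'f::field mat"
  assumes rep: "representation G n X" and g: "g \<in> carrier G" and h: "h \<in> p_regular p G"
  shows "brauer_character p r G X (g \<otimes> h \<otimes> inv g) = brauer_character p r G X h"
proof -
  note X = representationD[OF G rep]
  have hG: "h \<in> carrier G" using h by (simp add: p_regular_def)
  have "similar_mat (X (g \<otimes> h \<otimes> inv g)) (X h)"
  proof (rule similar_matI[of _ _ "X g" "X (inv g)" n])
    show "X g * X (inv g) = 1\<^sub>m n" "X (inv g) * X g = 1\<^sub>m n"
      using g X(2) by (simp_all flip: X(3))
    show "X (g \<otimes> h \<otimes> inv g) = X g * X h * X (inv g)"
      using g hG by (simp add: X(3))
  qed (use g hG X(1) in auto)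
  then show ?thesis
    using g h hG by (simp add: brauer_character_def conj_in_p_regular_iff char_poly_similar)
qed

lemma generalized_brauer_character_conj:
  assumes f: "f \<in> generalized_brauer_characters p r G" and g: "g \<in> carrier G" and h: "h \<in> p_regular p G"
  shows "f (g \<otimes> h \<otimes> inv g) = f h"
proof -
  have hG: "h \<in> carrier G" using h by (simp add: p_regular_def)
  obtain S c where S: "S \<subseteq> IBr p r G" and f: "f = (\<lambda>x\<in>p_regular p G. \<Sum>\<phi>\<in>S. of_int (c \<phi> :: int) * \<phi> x)"
    using f by (auto simp: generalized_brauer_characters_def)
  have "\<phi> (g \<otimes> h \<otimes> inv g) = \<phi> h" if \<phi>: "\<phi> \<in> S" for \<phi>
  proof -
    obtain X n where "\<phi> = brauer_character p r G X" "irreducible_representation G n X"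
      using S \<phi> by (auto simp: IBr_def)
    then show ?thesis
      using brauer_character_conj[OF _ g h] by (auto simp: irreducible_representation_def)
  qed
  then show ?thesis
    using g h hG by (auto simp: f conj_in_p_regular_iff intro: sum.cong)
qed

end

section \<open>Separating \<open>p\<close>-regular elements from \<open>H\<close>, and injectivity
  of restriction\<close>

lemma (in residue_setting) exists_vanishing_on_subgroup:
  fixes G :: "('g, 'b) monoid_scheme"
  assumes "group G" and "finite (carrier G)" and "subgroup H G" and x: "x \<in> p_regular p G"
    and not_conj: "\<And>g h. g \<in> carrier G \<Longrightarrow> h \<in> H \<Longrightarrow> x \<noteq> g \<otimes>\<^bsub>G\<^esub> h \<otimes>\<^bsub>G\<^esub> inv\<^bsub>G\<^esub> g"
  obtains f where "f \<in> generalized_brauer_characters p r G"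
    "\<And>h. h \<in> p_regular p G \<Longrightarrow> h \<in> H \<Longrightarrow> f h = 0" "f x \<noteq> 0"
proof -
  let ?Z = "generalized_brauer_characters p r G"
  interpret G: group G by (rule assms(1))
  have HG: "H \<subseteq> carrier G" and H1: "\<one>\<^bsub>G\<^esub> \<in> H"
    using assms(3) by (auto simp: subgroup.subset subgroup.one_closed)
  have xG: "x \<in> carrier G" using x by (simp add: p_regular_def)
  define C where "C = (\<lambda>g. g <#\<^bsub>G\<^esub> H) ` carrier G"
  have finC: "finite C" using assms(2) by (simp add: C_def)
  define Fix where "Fix g = {c \<in> C. g <#\<^bsub>G\<^esub> c = c}" for g
  have finF: "finite (Fix g)" for g using finC by (simp add: Fix_def)
  define u where "u g = card (Fix g)" for g
  have CG: "c \<subseteq> carrier G" if "c \<in> C" for c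
    using that HG G.l_coset_subset_G by (auto simp: C_def)
  have act: "g <#\<^bsub>G\<^esub> c \<in> C" if "g \<in> carrier G" "c \<in> C" for g c
    using that HG by (auto simp: C_def G.lcos_m_assoc)
  have act_mult: "(g \<otimes>\<^bsub>G\<^esub> h) <#\<^bsub>G\<^esub> c = g <#\<^bsub>G\<^esub> (h <#\<^bsub>G\<^esub> c)"
    if "g \<in> carrier G" "h \<in> carrier G" "c \<in> C" for g h c
    using that CG by (simp add: G.lcos_m_assoc)
  have u_pow: "(\<lambda>g\<in>p_regular p G. of_nat (u g ^ k)) \<in> ?Z" for k
  proof -
    \<comment> \<open>Lists of length \<open>k\<close> encode \<open>k\<close>-tuples of cosets. A
      list is fixed exactly when all its entries are, which gives \<open>u g ^ k\<close> fixed
      points.\<close>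
    let ?\<Omega> = "{cs. set cs \<subseteq> C \<and> length cs = k}"
    let ?act = "\<lambda>g. map (\<lambda>c. g <#\<^bsub>G\<^esub> c)"
    have "(\<lambda>g\<in>p_regular p G. of_nat (card {cs \<in> ?\<Omega>. ?act g cs = cs})) \<in> ?Z"
    proof (rule permutation_character_in_generalized[OF assms(1,2)])
      show "finite ?\<Omega>" by (rule finite_lists_length_eq[OF finC])
      show "?act g cs \<in> ?\<Omega>" if "g \<in> carrier G" "cs \<in> ?\<Omega>" for g cs
        using that act by auto
      show "?act \<one>\<^bsub>G\<^esub> cs = cs" if "cs \<in> ?\<Omega>" for cs
        using that CG G.lcos_mult_one by (intro map_idI) blast
      show "?act (g \<otimes>\<^bsub>G\<^esub> h) cs = ?act g (?act h cs)"
        if "g \<in> carrier G" "h \<in> carrier G" "cs \<in> ?\<Omega>" for g h cs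
        using that act_mult by (auto simp: subset_iff)
    qed
    moreover have "{cs \<in> ?\<Omega>. ?act g cs = cs} = {cs. set cs \<subseteq> Fix g \<and> length cs = k}" for g
    proof -
      have "?act g cs = cs \<longleftrightarrow> (\<forall>c\<in>set cs. g <#\<^bsub>G\<^esub> c = c)" for cs
        by (induction cs) auto
      then show ?thesis by (auto simp: Fix_def)
    qed
    ultimately show ?thesis
      by (simp add: card_lists_length_eq[OF finF] u_def)
  qed
  define n where "n = card C"
  \<comment> \<open>Each factor is \<open>k - X\<close>: the roots are the values 1 to
    \<open>n\<close> that \<open>u\<close> can take on \<open>H\<close>, and the value at 0 is the
    factorial of \<open>n\<close>.\<close>
  define q :: "int poly" where "q = (\<Prod>k=1..n. [:int k, -1:])"
  define f where "f = (\<lambda>g\<in>p_regular p G. of_int (poly q (int (u g))) :: complex)"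
  \<comment> \<open>Expanding \<open>q\<close> into monomials exhibits \<open>f\<close> as an
    integer combination of the powers of \<open>u\<close>.\<close>
  have "(\<lambda>g\<in>p_regular p G. \<Sum>i\<le>degree q. of_int (coeff q i) *
      (\<lambda>g\<in>p_regular p G. of_nat (u g ^ i)) g) \<in> ?Z"
    by (rule generalized_brauer_characters_sum[OF finite_atMost u_pow])
  also have "(\<lambda>g\<in>p_regular p G. \<Sum>i\<le>degree q. of_int (coeff q i) *
      (\<lambda>g\<in>p_regular p G. of_nat (u g ^ i)) g) = f"
    unfolding f_def by (rule restrict_ext) (simp add: poly_altdef)
  finally have fZ: "f \<in> ?Z" .
  have f0: "f h = 0" if h: "h \<in> p_regular p G" "h \<in> H" for h
  proof -
    \<comment> \<open>The trivial coset is fixed by every element of \<open>H\<close>, whence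
      \<open>u h \<ge> 1\<close>.\<close>
    have "H \<in> C"
      unfolding C_def by (rule image_eqI[of _ _ "\<one>\<^bsub>G\<^esub>"]) (simp_all add: G.lcos_mult_one[OF HG])
    then have "H \<in> Fix h"
      using h HG G.coset_join3[OF _ assms(3), of h] by (auto simp: Fix_def)
    then have "u h \<ge> 1"
      using finF[of h] by (auto simp: u_def Suc_le_eq card_gt_0_iff)
    moreover have "u h \<le> n"
      unfolding u_def n_def by (rule card_mono[OF finC]) (auto simp: Fix_def)
    ultimately have "poly q (int (u h)) = 0"
      by (auto simp: q_def poly_prod intro!: bexI[of _ "u h"])
    then show ?thesis using h by (simp add: f_def)
  qed
  have "Fix x = {}"
  proof -
    \<comment> \<open>If \<open>x\<close> fixes the coset of \<open>g\<close>, then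
      \<open>x \<otimes> g = g \<otimes> h\<close> for some \<open>h \<in> H\<close>, so
      \<open>x\<close> would be conjugate into \<open>H\<close>.\<close>
    have False if g: "g \<in> carrier G" and fixed: "x <#\<^bsub>G\<^esub> (g <#\<^bsub>G\<^esub> H) = g <#\<^bsub>G\<^esub> H" for g
    proof -
      have "g \<in> g <#\<^bsub>G\<^esub> H"
        using g H1 unfolding l_coset_def by (intro UN_I[of "\<one>\<^bsub>G\<^esub>"]) auto
      then have "x \<otimes>\<^bsub>G\<^esub> g \<in> x <#\<^bsub>G\<^esub> (g <#\<^bsub>G\<^esub> H)"
        unfolding l_coset_def[of G x] by blast
      then obtain h where h: "h \<in> H" "x \<otimes>\<^bsub>G\<^esub> g = g \<otimes>\<^bsub>G\<^esub> h"
        unfolding fixed by (auto simp: l_coset_def)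
      then have "x = g \<otimes>\<^bsub>G\<^esub> h \<otimes>\<^bsub>G\<^esub> inv\<^bsub>G\<^esub> g"
        using g xG HG by (intro G.inv_solve_right[THEN iffD2]) auto
      with not_conj[OF g h(1)] show False by contradiction
    qed
    then show ?thesis by (auto simp: Fix_def C_def)
  qed
  then have "f x = of_int (\<Prod>k=1..n. int k)"
    using x by (simp add: f_def u_def q_def poly_prod)
  then have "f x \<noteq> 0" by simp
  with that fZ f0 show thesis by blast
qed

theorem theoremA:
  fixes G :: "('g, 'b) monoid_scheme" and H :: "'g set" and p :: nat
    and M :: "complex set" and \<iota> :: "complex set \<Rightarrow> 'f::field"
  assumes "group G" and "finite (carrier G)" and "subgroup H G" and "Factorial_Ring.prime p"
    and "maximalideal M alg_int_ring" and "of_nat p \<in> M"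
    and "\<iota> \<in> ring_iso (alg_int_ring Quot M) (class_ring :: 'f ring)"
  shows "inj_on (brauer_restriction p G H)
           (generalized_brauer_characters p (residue_map M \<iota>) G) \<longleftrightarrow>
         (\<forall>x\<in>p_regular p G. \<exists>g\<in>carrier G. x \<in> (g <#\<^bsub>G\<^esub> H) #>\<^bsub>G\<^esub> (inv\<^bsub>G\<^esub> g))"
    (is "inj_on ?res ?Z \<longleftrightarrow> ?conj")
proof -
  interpret residue_setting p M \<iota>
    using assms(4-7) by (rule residue_setting.intro)
  have HG: "H \<subseteq> carrier G"
    using assms(3) by (rule subgroup.subset)
  have preg_H: "p_regular p (G\<lparr>carrier := H\<rparr>) = p_regular p G \<inter> H"
    by (rule p_regular_subgroup[OF assms(1,3)])
  have conj_iff: "x \<in> (g <#\<^bsub>G\<^esub> H) #>\<^bsub>G\<^esub> (inv\<^bsub>G\<^esub> g) \<longleftrightarrow> (\<exists>h\<in>H. x = g \<otimes>\<^bsub>G\<^esub> h \<otimes>\<^bsub>G\<^esub> inv\<^bsub>G\<^esub> g)" for x g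
    by (auto simp: l_coset_def r_coset_def)
  show ?thesis
  proof
    assume conj: ?conj
    show "inj_on ?res ?Z"
    proof (rule inj_onI)
      fix f1 f2 assume f: "f1 \<in> ?Z" "f2 \<in> ?Z" and eq: "?res f1 = ?res f2"
      have "f1 x = f2 x" if x: "x \<in> p_regular p G" for x
      proof -
        obtain g h where g: "g \<in> carrier G" and h: "h \<in> H" and x_eq: "x = g \<otimes>\<^bsub>G\<^esub> h \<otimes>\<^bsub>G\<^esub> inv\<^bsub>G\<^esub> g"
          using conj x unfolding conj_iff by blast
        \<comment> \<open>Conjugation preserves \<open>p\<close>-regularity, so \<open>h\<close>
          lies in the domain of the restricted functions.\<close>
        have hp: "h \<in> p_regular p G"
          using x g h HG conj_in_p_regular_iff[OF assms(1) g, of h p] by (auto simp: x_eq)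
        have "f1 h = f2 h"
          using fun_cong[OF eq, of h] h hp by (simp add: brauer_restriction_def preg_H)
        then show ?thesis
          unfolding x_eq using generalized_brauer_character_conj[OF assms(1) _ g hp] f by metis
      qed
      \<comment> \<open>Outside the \<open>p\<close>-regular elements both functions are
        \<open>undefined\<close>.\<close>
      moreover have "f1 x = f2 x" if "x \<notin> p_regular p G" for x
        using f that by (auto simp: generalized_brauer_characters_def)
      ultimately show "f1 = f2" by blast
    qed
  next
    assume inj: "inj_on ?res ?Z"
    show ?conj
    proof (rule ccontr)
      assume "\<not> ?conj"
      then obtain x where x: "x \<in> p_regular p G"
        and not_conj: "\<And>g h. g \<in> carrier G \<Longrightarrow> h \<in> H \<Longrightarrow> x \<noteq> g \<otimes>\<^bsub>G\<^esub> h \<otimes>\<^bsub>G\<^esub> inv\<^bsub>G\<^esub> g"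
        unfolding conj_iff by blast
      obtain f where fZ: "f \<in> ?Z" and f0: "\<And>h. h \<in> p_regular p G \<Longrightarrow> h \<in> H \<Longrightarrow> f h = 0"
        and fx: "f x \<noteq> 0"
        using exists_vanishing_on_subgroup[OF assms(1-3) x not_conj] by blast
      \<comment> \<open>The functions \<open>f\<close> and 0 have the same restriction to
        \<open>H\<close>, so injectivity would force \<open>f = 0\<close>, against
        \<open>f x \<noteq> 0\<close>.\<close>
      have "?res f = ?res (\<lambda>g\<in>p_regular p G. 0)"
        using f0 by (auto simp: brauer_restriction_def preg_H restrict_def)
      then have "f = (\<lambda>g\<in>p_regular p G. 0)"
        by (rule inj_onD[OF inj _ fZ generalized_brauer_characters_0])
      with fx x show False by simp
    qed
  qed
qed

end
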